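(* Let $T$ be an odd tree of order $n$, where $n\ge 4$. If $I$ is a nondecreasing distance-based topological index, then \[ I(T)\le I(T_n). \] If $I$ is a nonincreasing distance-based topological index, then \[ I(T)\ge I(T_n). \]
   Context: All graphs are finite and simple. The order of a graph is its number of vertices. An odd tree is a tree in which every vertex has odd degree; by the handshake lemma odd trees have even order. For even $n\ge 6$, $T_n$ denotes the tree obtained from the path $P_{n/2+1}$ on $n/2+1$ vertices by attaching one leaf to each internal vertex of the path; for $n=4$, $T_4$ is the star $S_4$ of order $4$. Thus $T_n$ is an odd tree of order $n$. For a connected graph $G$, $d_G(u,v)$ is the usual shortest-path distance. The distance sequence $\mathcal{D}(G)$ of a connected graph $G$ is the nondecreasing sequence (of length $\binom{n}{2}$ if $G$ has order $n$) of the distances between all unordered pairs of distinct vertices of $G$, with repetitions. A topological index $I$, assigning a real number to each connected graph, is distance-based if it can be expressed in the form $I(G)=g(\mathcal{D}(G))$, where $g$ is a real-valued function defined on the set of all finite sequences of positive integers. It is called nondecreasing (nonincreasing) if $g$, when restricted to sequences of any fixed length, is nondecreasing (nonincreasing) in every coordinate. *)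

theory Defs
  imports "Graph_Theory.Graph_Theory" "HOL-Library.Multiset"
begin

text \<open>
  A finite simple graph is a \<^locale>\<open>pair_graph\<close>: an undirected edge between u and v is
  represented by the two arcs (u,v) and (v,u).  Hence the degree of a vertex is its out-degree.
\<close>

definition connected_graph :: "'a pair_pre_digraph \<Rightarrow> bool" where
  "connected_graph G \<longleftrightarrow> pair_graph G \<and> Digraph_Component.connected (with_proj G)"

text \<open>
  The library predicate \<^const>\<open>tree\<close> is unsuitable here: it forbids all directed cycles,
  and every edge, traversed back and forth, is a directed cycle of length 2.  The
  cycles of an undirected simple graph are the directed cycles of length at least 3.
\<close>

definition tree_graph :: "'a pair_pre_digraph \<Rightarrow> bool" where
  "tree_graph G \<longleftrightarrow> connected_graph G \<and>
     \<not> (\<exists>p. pre_digraph.cycle (with_proj G) p \<and> 3 \<le> length p)"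

definition odd_tree :: "'a pair_pre_digraph \<Rightarrow> bool" where
  "odd_tree G \<longleftrightarrow> tree_graph G \<and> (\<forall>v \<in> pverts G. odd (out_degree (with_proj G) v))"

definition gdist :: "'a pair_pre_digraph \<Rightarrow> 'a \<Rightarrow> 'a \<Rightarrow> nat" where
  "gdist G u v = (LEAST k. \<exists>p. pre_digraph.awalk (with_proj G) u p v \<and> length p = k)"

text \<open>
  The common value of the distance for both orders of the two elements of e.
\<close>

definition pair_gdist :: "'a pair_pre_digraph \<Rightarrow> 'a set \<Rightarrow> nat" where
  "pair_gdist G e = (THE k. \<exists>u v. e = {u, v} \<and> u \<noteq> v \<and> k = gdist G u v)"

definition dist_seq :: "'a pair_pre_digraph \<Rightarrow> nat list" where
  "dist_seq G = sorted_list_of_multiset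
     (image_mset (pair_gdist G) (mset_set {e. e \<subseteq> pverts G \<and> card e = 2}))"

text \<open>
  Only the values of an index I on connected graphs, and of g on sequences of positive
  integers, are relevant.
\<close>

definition distance_based_via :: "('a pair_pre_digraph \<Rightarrow> real) \<Rightarrow> (nat list \<Rightarrow> real) \<Rightarrow> bool" where
  "distance_based_via I g \<longleftrightarrow> (\<forall>G. connected_graph G \<longrightarrow> I G = g (dist_seq G))"

definition coordinatewise_nondecreasing :: "(nat list \<Rightarrow> real) \<Rightarrow> bool" where
  "coordinatewise_nondecreasing g \<longleftrightarrow>
     (\<forall>xs i m. (\<forall>x \<in> set xs. 0 < x) \<and> i < length xs \<and> xs ! i \<le> m
        \<longrightarrow> g xs \<le> g (xs[i := m]))"

definition coordinatewise_nonincreasing :: "(nat list \<Rightarrow> real) \<Rightarrow> bool" where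
  "coordinatewise_nonincreasing g \<longleftrightarrow>
     (\<forall>xs i m. (\<forall>x \<in> set xs. 0 < x) \<and> i < length xs \<and> xs ! i \<le> m
        \<longrightarrow> g xs \<ge> g (xs[i := m]))"

definition nondecreasing_distance_based :: "('a pair_pre_digraph \<Rightarrow> real) \<Rightarrow> bool" where
  "nondecreasing_distance_based I \<longleftrightarrow>
     (\<exists>g. distance_based_via I g \<and> coordinatewise_nondecreasing g)"

definition nonincreasing_distance_based :: "('a pair_pre_digraph \<Rightarrow> real) \<Rightarrow> bool" where
  "nonincreasing_distance_based I \<longleftrightarrow>
     (\<exists>g. distance_based_via I g \<and> coordinatewise_nonincreasing g)"

text \<open>
  For even n at least 4, the path is 0, 1, ..., n div 2, its internal vertices are the i with
  0 < i < n div 2, and the leaf attached to i is the vertex n div 2 + i.  For n = 4 this is the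
  star of order 4, with centre 1.
\<close>

definition T_graph :: "nat \<Rightarrow> nat pair_pre_digraph" where
  "T_graph n =
     (let E = {(i, Suc i) | i. i < n div 2} \<union> {(i, n div 2 + i) | i. 0 < i \<and> i < n div 2}
      in \<lparr> pverts = {..<n}, parcs = E \<union> E\<inverse> \<rparr>)"

lemma pverts_T_graph [simp]: "pverts (T_graph n) = {..<n}"
  by (simp add: T_graph_def Let_def)

lemma in_parcs_T_graph:
  "(a, b) \<in> parcs (T_graph n) \<longleftrightarrow>
     (a < n div 2 \<and> b = Suc a) \<or> (0 < a \<and> a < n div 2 \<and> b = n div 2 + a) \<or>
     (b < n div 2 \<and> a = Suc b) \<or> (0 < b \<and> b < n div 2 \<and> a = n div 2 + b)"
  unfolding T_graph_def Let_def by auto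

lemma pair_graph_T_graph:
  assumes "even n" "4 \<le> n"
  shows "pair_graph (T_graph n)"
proof -
  have verts: "a < n \<and> b < n \<and> a \<noteq> b" if "(a, b) \<in> parcs (T_graph n)" for a b
    using that assms unfolding in_parcs_T_graph by presburger
  have fin: "finite (parcs (T_graph n))"
    by (rule finite_subset[of _ "{..<n} \<times> {..<n}"]) (auto dest: verts)
  have "sym (parcs (T_graph n))"
    by (rule symI) (auto simp: in_parcs_T_graph)
  then have "symmetric (with_proj (T_graph n))"
    by (simp add: symmetric_def)
  then show ?thesis
    using fin verts by unfold_locales force+
qed

lemma T_graph_4: "parcs (T_graph 4) = {1} \<times> {0, 2, 3} \<union> {0, 2, 3} \<times> {1}"
proof -
  have "(a, b) \<in> parcs (T_graph 4) \<longleftrightarrow> (a, b) \<in> {1} \<times> {0, 2, 3} \<union> {0, 2, 3} \<times> {1}" for a b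
    unfolding in_parcs_T_graph by simp presburger
  then show ?thesis by (simp add: set_eq_iff)
qed

end

theory Submission
  imports Defs
begin

text \<open>
  Two deepest siblings of an odd tree are leaves, and removing them leaves an odd tree; so every odd
  tree arises from an edge by repeatedly attaching two leaves x, y to a vertex v.  This creates, up to
  distance k, as many new pairs as the ball of radius k - 1 around v dictates.  By induction along the
  same construction, a ball of radius k \<ge> 1 in an odd tree of order n has at least min n (2 k)
  vertices.  Around an end of the path of T_n this minimum is attained, and T_n is built by always
  attaching at such an end.  Hence for every k an odd tree has at least as many pairs at distance at
  most k as T_n, which says that its sorted distance sequence is below that of T_n in every coordinate.
\<close>

section \<open>Comparing sorted sequences\<close>

text \<open>Otherwise the threshold \<open>k = ys ! i\<close> separates the lists: \<open>ys\<close>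
  has at least \<open>i + 1\<close> entries up to it, while in \<open>xs\<close> all such entries
  have an index below \<open>i\<close>.\<close>

lemma sorted_nth_le_nth_if_counts:
  fixes xs ys :: "'b::linorder list"
  assumes "sorted xs" "sorted ys" "length xs = length ys" "i < length xs"
    and counts: "\<And>k. length (filter (\<lambda>y. y \<le> k) ys) \<le> length (filter (\<lambda>x. x \<le> k) xs)"
  shows "xs ! i \<le> ys ! i"
proof (rule ccontr)
  assume "\<not> xs ! i \<le> ys ! i"
  then have less: "ys ! i < xs ! i" by simp
  have "{..i} \<subseteq> {j. j < length ys \<and> ys ! j \<le> ys ! i}"
    using assms by (auto intro: sorted_nth_mono)
  then have "card {..i} \<le> card {j. j < length ys \<and> ys ! j \<le> ys ! i}"
    by (rule card_mono[rotated]) simp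
  then have ge: "Suc i \<le> length (filter (\<lambda>y. y \<le> ys ! i) ys)"
    by (simp add: length_filter_conv_card)
  have "j < i" if "j < length xs" "xs ! j \<le> ys ! i" for j
    using that assms less by (metis leD le_less_trans not_le_imp_less sorted_nth_mono)
  then have "{j. j < length xs \<and> xs ! j \<le> ys ! i} \<subseteq> {..<i}" by auto
  then have "card {j. j < length xs \<and> xs ! j \<le> ys ! i} \<le> card {..<i}"
    by (rule card_mono[rotated]) simp
  then have "length (filter (\<lambda>x. x \<le> ys ! i) xs) \<le> i"
    by (simp add: length_filter_conv_card)
  then show False using ge counts[of "ys ! i"] by simp
qed

text \<open>Entries of \<open>xs\<close> are replaced by those of \<open>ys\<close> one at a time
  from the left. Every intermediate list stays positive, since \<open>ys\<close> dominates the
  positive list \<open>xs\<close>, so monotonicity in a single coordinate applies at each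
  step.\<close>

lemma coordinatewise_nondecreasingD:
  assumes g: "coordinatewise_nondecreasing g"
    and "length xs = length ys" "\<forall>x \<in> set xs. 0 < x"
    and le: "\<And>i. i < length xs \<Longrightarrow> xs ! i \<le> ys ! i"
  shows "g xs \<le> g ys"
proof -
  have "g xs \<le> g (take k ys @ drop k xs)" if "k \<le> length xs" for k
    using that
  proof (induction k)
    case (Suc k)
    let ?zs = "take k ys @ drop k xs"
    have k: "k < length xs" using Suc.prems by simp
    have "0 < z" if z: "z \<in> set ?zs" for z
    proof -
      consider "z \<in> set (take k ys)" | "z \<in> set xs"
        using z by (auto dest: in_set_dropD)
      then show ?thesis
      proof cases
        case 1
        then obtain j where "j < k" "z = ys ! j"
          using k assms(2) by (auto simp: in_set_conv_nth)
        then show ?thesis using le[of j] assms(3) k by (metis le_trans less_le_trans nth_mem less_trans)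
      qed (use assms(3) in auto)
    qed
    moreover have "?zs ! k = xs ! k"
      using k assms(2) by (simp add: nth_append)
    moreover have "?zs[k := ys ! k] = take (Suc k) ys @ drop (Suc k) xs"
      using k assms(2)
      by (simp add: list_update_append take_Suc_conv_app_nth Cons_nth_drop_Suc[symmetric])
    moreover have "k < length ?zs" using k assms(2) by simp
    ultimately have "\<forall>z \<in> set ?zs. 0 < z" "k < length ?zs" "?zs ! k \<le> ys ! k"
      and upd: "?zs[k := ys ! k] = take (Suc k) ys @ drop (Suc k) xs"
      using le[OF k] by auto
    then have "g ?zs \<le> g (?zs[k := ys ! k])"
      using g unfolding coordinatewise_nondecreasing_def by blast
    then have "g ?zs \<le> g (take (Suc k) ys @ drop (Suc k) xs)" unfolding upd .
    then show ?case using Suc by simp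
  qed simp
  from this[of "length xs"] show ?thesis using assms(2) by simp
qed

section \<open>Close pairs\<close>

text \<open>Ordered pairs including the diagonal make the gain from new vertices a union of
  products; \<open>count_dist_seq\<close> converts back to unordered pairs.\<close>

definition close_pairs :: "('a \<Rightarrow> 'a \<Rightarrow> nat) \<Rightarrow> 'a set \<Rightarrow> nat \<Rightarrow> ('a \<times> 'a) set" where
  "close_pairs d V k = {(u, w). u \<in> V \<and> w \<in> V \<and> d u w \<le> k}"

lemma finite_close_pairs [simp]: "finite V \<Longrightarrow> finite (close_pairs d V k)"
  by (rule finite_subset[of _ "V \<times> V"]) (auto simp: close_pairs_def)

text \<open>The relation \<open>adj\<close> is a parameter so that it can be taken as
  \<open>d u v \<le> 1\<close>. The new vertices may be related to further vertices of
  \<open>V\<close>; this can only create more close pairs.\<close>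

inductive sibling_built :: "('a \<Rightarrow> 'a \<Rightarrow> bool) \<Rightarrow> 'a set \<Rightarrow> bool" for adj where
  edge: "adj a b \<Longrightarrow> a \<noteq> b \<Longrightarrow> sibling_built adj {a, b}"
| siblings: "sibling_built adj V \<Longrightarrow> v \<in> V \<Longrightarrow> x \<notin> V \<Longrightarrow> y \<notin> V \<Longrightarrow> x \<noteq> y \<Longrightarrow>
    adj v x \<Longrightarrow> adj v y \<Longrightarrow> sibling_built adj (insert x (insert y V))"

lemma sibling_built_finite: "sibling_built adj V \<Longrightarrow> finite V"
  and sibling_built_even: "sibling_built adj V \<Longrightarrow> even (card V)"
  and sibling_built_card: "sibling_built adj V \<Longrightarrow> 2 \<le> card V"
proof -
  assume "sibling_built adj V"
  then have "finite V \<and> even (card V) \<and> 2 \<le> card V"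
    by induction auto
  then show "finite V" "even (card V)" "2 \<le> card V" by auto
qed

section \<open>Ball sizes and close pairs in a metric\<close>

locale nat_metric =
  fixes U :: "'a set" and d :: "'a \<Rightarrow> 'a \<Rightarrow> nat"
  assumes dist_self: "u \<in> U \<Longrightarrow> d u u = 0"
    and dist_commute: "u \<in> U \<Longrightarrow> v \<in> U \<Longrightarrow> d u v = d v u"
    and dist_triangle: "u \<in> U \<Longrightarrow> v \<in> U \<Longrightarrow> w \<in> U \<Longrightarrow> d u w \<le> d u v + d v w"
begin

text \<open>For an old centre, either the old vertices already suffice, or the ball of radius
  \<open>k - 1\<close> is all of \<open>V\<close> and radius \<open>k\<close> reaches both new
  vertices. For a new centre, the ball contains both siblings and the ball of radius
  \<open>k - 1\<close> around their parent \<open>v\<close>.\<close>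

lemma ball_card_ge:
  assumes "sibling_built (\<lambda>u v. d u v \<le> 1) V" "V \<subseteq> U" "u \<in> V" "1 \<le> k"
  shows "min (card V) (2 * k) \<le> card {w \<in> V. d u w \<le> k}"
  using assms
proof (induction arbitrary: u k)
  case (edge a b)
  then have "{w \<in> {a, b}. d u w \<le> k} = {a, b}"
    using dist_commute[of a b] dist_self[of a] dist_self[of b] by auto
  then show ?case using edge by simp
next
  case (siblings V v x y)
  let ?V' = "insert x (insert y V)"
  have fin: "finite V" and ev: "even (card V)" and c2: "2 \<le> card V"
    using siblings.hyps sibling_built_finite sibling_built_even sibling_built_card by blast+
  have card': "card ?V' = card V + 2" using siblings.hyps fin by simp
  have VU: "V \<subseteq> U" and U: "x \<in> U" "y \<in> U" "v \<in> U" using siblings by auto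
  have near: "d u z \<le> d u v + 1" if "u \<in> U" "z = x \<or> z = y" for u z
    using dist_triangle[of u v z] that U siblings.hyps by fastforce
  show ?case
  proof (cases "u \<in> V")
    case True
    let ?B = "{w \<in> V. d u w \<le> k}"
    have B: "min (card V) (2 * k) \<le> card ?B"
      using siblings.IH[OF VU True] siblings.prems by simp
    show ?thesis
    proof (cases "2 * k \<le> card V")
      case True
      then have "2 * k \<le> card ?B" using B by simp
      also have "\<dots> \<le> card {w \<in> ?V'. d u w \<le> k}"
        using fin by (intro card_mono) auto
      finally show ?thesis by simp
    next
      case False
      \<comment> \<open>Since \<open>card V\<close> is even and less than \<open>2 * k\<close>, it
        is at most \<open>2 * k - 2\<close>; being at least 2, it leaves a radius
        \<open>k - 1\<close> to which the induction hypothesis applies.\<close>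
      then have k: "card V \<le> 2 * (k - 1)" "1 \<le> k - 1" using ev c2 by presburger+
      then have "card V \<le> card {w \<in> V. d u w \<le> k - 1}"
        using siblings.IH[OF VU True k(2)] by simp
      then have all: "{w \<in> V. d u w \<le> k - 1} = V"
        using fin by (intro card_seteq) auto
      then have "d u v \<le> k - 1" using siblings.hyps by blast
      then have "d u x \<le> k" "d u y \<le> k"
        using near[of u x] near[of u y] True VU siblings.prems by auto
      moreover have "d u w \<le> k" if "w \<in> V" for w
        using all that by force
      ultimately have "{w \<in> ?V'. d u w \<le> k} = ?V'" by auto
      then show ?thesis by simp
    qed
  next
    case False
    \<comment> \<open>The centre \<open>u\<close> is one of the two new vertices and
      \<open>y'\<close> is the other.\<close>
    then obtain y' where y': "{u, y'} = {x, y}" "u \<noteq> y'" "u \<in> U" "y' \<in> U" "u \<notin> V" "y' \<notin> V"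
        "d v u \<le> 1" "d v y' \<le> 1"
      using siblings.prems siblings.hyps U by (metis insert_commute insertE)
    have V': "?V' = insert u (insert y' V)" using y'(1) by auto
    show ?thesis
    \<comment> \<open>For \<open>k = 1\<close> the ball around \<open>v\<close> would have radius 0,
      outside the induction hypothesis; here \<open>u\<close> and \<open>v\<close> themselves are
      two vertices of the ball.\<close>
    proof (cases "k = 1")
      case True
      have "d u v \<le> k" using dist_commute[of u v] True y' U by simp
      then have "{u, v} \<subseteq> {w \<in> ?V'. d u w \<le> k}"
        using dist_self[of u] y' siblings.hyps V' by auto
      then have "card {u, v} \<le> card {w \<in> ?V'. d u w \<le> k}"
        using fin by (intro card_mono) auto
      moreover have "u \<noteq> v" using False siblings.hyps by auto
      ultimately show ?thesis using True by simp
    next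
      case False
      let ?B = "{w \<in> V. d v w \<le> k - 1}"
      have k: "1 \<le> k - 1" using False siblings.prems by simp
      have B: "min (card V) (2 * (k - 1)) \<le> card ?B"
        using siblings.IH[OF VU _ k] siblings.hyps by blast
      have "d u w \<le> k" if "w \<in> V" "d v w \<le> k - 1" for w
        using dist_triangle[of u v w] that y' U VU dist_commute[of u v] k by auto
      moreover have "d u y' \<le> k"
        using dist_triangle[of u v y'] y' U dist_commute[of u v] k by auto
      ultimately have "insert u (insert y' ?B) \<subseteq> {w \<in> ?V'. d u w \<le> k}"
        unfolding V' using dist_self[of u] y' by auto
      then have "card (insert u (insert y' ?B)) \<le> card {w \<in> ?V'. d u w \<le> k}"
        using fin by (intro card_mono) auto
      moreover have "card (insert u (insert y' ?B)) = card ?B + 2"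
        using y' fin by simp
      ultimately show ?thesis using B card' k by simp
    qed
  qed
qed

end

text \<open>
  The vertex \<open>0\<close> has the child \<open>1\<close>, and every odd vertex \<open>2 * i - 1\<close> has the two children
  \<open>2 * i\<close> and \<open>2 * i + 1\<close>.  In this numbering the extremal tree of order \<open>2 * m\<close> is the
  subtree induced by \<open>{..<2 * m}\<close>, so that the trees for different orders are nested.  The vertex
  \<open>u\<close> is at position \<open>(u + 1) div 2\<close> of the path; positive even vertices hang off it.
\<close>

definition cat_dist :: "nat \<Rightarrow> nat \<Rightarrow> nat" where
  "cat_dist u w = (if u = w then 0 else
     ((u + 1) div 2 - (w + 1) div 2) + ((w + 1) div 2 - (u + 1) div 2) +
     (if even u \<and> 0 < u then 1 else 0) + (if even w \<and> 0 < w then 1 else 0))"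

text \<open>Distinct vertices share a position only as \<open>2 * i - 1\<close> and its pendant
  \<open>2 * i\<close>, and the pendant contributes 1.\<close>

lemma cat_dist_eq_0_iff: "cat_dist u w = 0 \<longleftrightarrow> u = w"
proof -
  have "u = w" if "(u + 1) div 2 = (w + 1) div 2" "odd u \<or> u = 0" "odd w \<or> w = 0"
    using that by presburger
  then show ?thesis unfolding cat_dist_def by (auto split: if_splits)
qed

lemma cat_dist_sym: "cat_dist u w = cat_dist w u"
  unfolding cat_dist_def by auto

text \<open>The centre is the far end of the path. For \<open>0 < j < m\<close> the ball has
  \<open>j + 1\<close> path vertices and the \<open>j - 1\<close> pendants strictly between its
  extreme positions. For \<open>j = 0\<close> the centre alone remains, which \<open>2 * j\<close>
  would miss.\<close>

lemma cat_ball_card_le: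
  assumes "1 \<le> m"
  shows "card {w \<in> {..<2 * m}. cat_dist (2 * m - 1) w \<le> j} \<le> (if j = 0 then 1 else min (2 * m) (2 * j))"
proof (cases "j = 0")
  case True
  then have "{w \<in> {..<2 * m}. cat_dist (2 * m - 1) w \<le> j} \<subseteq> {2 * m - 1}"
    by (auto simp: cat_dist_eq_0_iff)
  then have "card {w \<in> {..<2 * m}. cat_dist (2 * m - 1) w \<le> j} \<le> card {2 * m - 1}"
    by (rule card_mono[rotated]) simp
  then show ?thesis using True by simp
next
  case False
  let ?B = "{w \<in> {..<2 * m}. cat_dist (2 * m - 1) w \<le> j}"
  have "card ?B \<le> card {..<2 * m}" by (rule card_mono) auto
  then have 1: "card ?B \<le> 2 * m" by simp
  have "card ?B \<le> 2 * j" if "j < m"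
  proof -
    have "?B \<subseteq> insert (2 * (m - j) - 1) {2 * (m - j) + 1..<2 * m}"
    proof
      fix w assume w: "w \<in> ?B"
      have m: "(2 * m - 1 + 1) div 2 = m" "odd (2 * m - 1)" using assms by auto
      have le: "w < 2 * m" "cat_dist (2 * m - 1) w \<le> j" using w by auto
      show "w \<in> insert (2 * (m - j) - 1) {2 * (m - j) + 1..<2 * m}"
      proof (cases "even w")
        case True
        then obtain i where i: "w = 2 * i" by (elim evenE)
        then show ?thesis using le m that assms unfolding cat_dist_def
          by (auto split: if_splits)
      next
        case False
        then obtain i where i: "w = 2 * i + 1" by (elim oddE)
        then show ?thesis using le m that assms unfolding cat_dist_def
          by (auto split: if_splits)
      qed
    qed
    then have "card ?B \<le> card (insert (2 * (m - j) - 1) {2 * (m - j) + 1..<2 * m})"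
      by (rule card_mono[rotated]) simp
    also have "\<dots> \<le> Suc (card {2 * (m - j) + 1..<2 * m})"
      by (rule card_insert_le_m1) auto
    finally show ?thesis using that False by simp
  qed
  then show ?thesis using 1 False by fastforce
qed

text \<open>The pairs gained by attaching the leaves x and y to v, where B is the ball of radius
  k - 1 around v.\<close>

definition sibling_pairs :: "'a \<Rightarrow> 'a \<Rightarrow> 'a set \<Rightarrow> nat \<Rightarrow> ('a \<times> 'a) set" where
  "sibling_pairs x y B k = {x, y} \<times> B \<union> B \<times> {x, y} \<union> {(x, x), (y, y)} \<union>
     (if 2 \<le> k then {(x, y), (y, x)} else {})"

text \<open>Each element of \<open>B\<close> yields four ordered pairs, the diagonal two, and the
  siblings, joined through their parent by two edges, two more once
  \<open>2 \<le> k\<close>.\<close>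

lemma card_sibling_pairs:
  assumes "finite B" "x \<notin> B" "y \<notin> B" "x \<noteq> y"
  shows "card (sibling_pairs x y B k) = 4 * card B + (if 2 \<le> k then 4 else 2)"
proof -
  have "card ({x, y} \<times> B \<union> B \<times> {x, y}) = 4 * card B"
    using assms by (subst card_Un_disjoint) (auto simp: card_cartesian_product)
  moreover have "card ({x, y} \<times> B \<union> B \<times> {x, y} \<union> {(x, x), (y, y)}) =
      card ({x, y} \<times> B \<union> B \<times> {x, y}) + 2"
    using assms by (subst card_Un_disjoint) auto
  moreover have "card (({x, y} \<times> B \<union> B \<times> {x, y} \<union> {(x, x), (y, y)}) \<union> {(x, y), (y, x)}) =
      card ({x, y} \<times> B \<union> B \<times> {x, y} \<union> {(x, x), (y, y)}) + 2"
    using assms by (subst card_Un_disjoint) auto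
  moreover have "sibling_pairs x y B k = (if 2 \<le> k
      then {x, y} \<times> B \<union> B \<times> {x, y} \<union> {(x, x), (y, y)} \<union> {(x, y), (y, x)}
      else {x, y} \<times> B \<union> B \<times> {x, y} \<union> {(x, x), (y, y)})"
    by (simp only: sibling_pairs_def Un_empty_right split: if_split) blast
  ultimately show ?thesis by presburger
qed

text \<open>Both sides grow in parallel: \<open>x\<close> and \<open>y\<close> are attached to
  \<open>v\<close>, while \<open>2 * m\<close> and \<open>2 * m + 1\<close> are attached to the path
  end \<open>2 * m - 1\<close>. The gains depend only on the balls of radius \<open>k - 1\<close>,
  which \<open>ball_card_ge\<close> and \<open>cat_ball_card_le\<close> compare.\<close>

lemma (in nat_metric) close_pairs_cat_dist_le:
  assumes "sibling_built (\<lambda>u v. d u v \<le> 1) V" "V \<subseteq> U"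
  shows "card (close_pairs cat_dist {..<card V} k) \<le> card (close_pairs d V k)"
\<comment> \<open>Truncated subtraction would turn the radius \<open>k - 1\<close> into 0 and count
  pairs at distance 1, so for \<open>k = 0\<close> the diagonals are compared directly.\<close>
proof (cases "k = 0")
  case True
  have fin: "finite V" using assms sibling_built_finite by blast
  have "(\<lambda>u. (u, u)) ` V \<subseteq> close_pairs d V k"
    using assms dist_self by (auto simp: close_pairs_def)
  then have "card ((\<lambda>u. (u, u)) ` V) \<le> card (close_pairs d V k)"
    using fin by (intro card_mono) auto
  moreover have "card ((\<lambda>u. (u, u)) ` V) = card V" by (rule card_image) (auto simp: inj_on_def)
  moreover have "close_pairs cat_dist {..<card V} k = (\<lambda>u. (u, u)) ` {..<card V}"
    using True by (auto simp: close_pairs_def cat_dist_eq_0_iff)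
  then have "card (close_pairs cat_dist {..<card V} k) \<le> card V"
    by (metis card_image_le card_lessThan finite_lessThan)
  ultimately show ?thesis by simp
next
  case False
  then have k: "1 \<le> k" by simp
  show ?thesis using assms
  proof induction
    case (edge a b)
    then have "close_pairs d {a, b} k = {a, b} \<times> {a, b}"
      using k dist_self[of a] dist_self[of b] dist_commute[of a b] by (auto simp: close_pairs_def)
    then have "card (close_pairs d {a, b} k) = 4" using edge by (simp add: card_cartesian_product)
    moreover have "close_pairs cat_dist {..<card {a, b}} k \<subseteq> {..<card {a, b}} \<times> {..<card {a, b}}"
      by (auto simp: close_pairs_def)
    then have "card (close_pairs cat_dist {..<card {a, b}} k) \<le> card ({..<card {a, b}} \<times> {..<card {a, b}})"
      by (intro card_mono) auto
    ultimately show ?case using edge by (simp add: card_cartesian_product)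
  next
    case (siblings V v x y)
    let ?V' = "insert x (insert y V)"
    have fin: "finite V" and ev: "even (card V)" and c2: "2 \<le> card V"
      using siblings.hyps sibling_built_finite sibling_built_even sibling_built_card by blast+
    then obtain m where m: "card V = 2 * m" "1 \<le> m" by (auto elim!: evenE)
    have card': "card ?V' = 2 * m + 2" using siblings.hyps fin m by simp
    have VU: "V \<subseteq> U" and U: "x \<in> U" "y \<in> U" "v \<in> U" using siblings by auto
    define B where "B = {w \<in> V. d v w \<le> k - 1}"
    define C where "C = {w \<in> {..<2 * m}. cat_dist (2 * m - 1) w \<le> k - 1}"
    \<comment> \<open>For \<open>k = 1\<close> both balls have radius 0, which
      \<open>ball_card_ge\<close> does not cover; the ball around \<open>v\<close> then contains at
      least \<open>v\<close>.\<close>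
    have BC: "card C \<le> card B"
    proof (cases "k = 1")
      case True
      then have "v \<in> B" using dist_self[of v] siblings.hyps U by (simp add: B_def)
      then have "1 \<le> card B" using fin by (simp add: B_def Suc_le_eq card_gt_0_iff) blast
      then show ?thesis using cat_ball_card_le[OF m(2), of "k - 1"] True unfolding C_def by simp
    next
      case False
      then have "min (card V) (2 * (k - 1)) \<le> card B"
        using ball_card_ge[OF siblings.hyps(1) VU siblings.hyps(2), of "k - 1"] k
        unfolding B_def by simp
      moreover have "card C \<le> min (card V) (2 * (k - 1))"
        using cat_ball_card_le[OF m(2), of "k - 1"] False k m unfolding C_def by simp
      ultimately show ?thesis by linarith
    qed
    have near: "d z w \<le> k" "d w z \<le> k" if "w \<in> B" "z = x \<or> z = y" for w z
    proof -
      have w: "w \<in> U" "d v w \<le> k - 1" using that VU by (auto simp: B_def)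
      show "d w z \<le> k" using dist_triangle[of w v z] dist_commute[of w v] w that U siblings.hyps k by auto
      then show "d z w \<le> k" using dist_commute[of z w] w that U by auto
    qed
    have xy: "d x y \<le> k" "d y x \<le> k" if "2 \<le> k"
      using dist_triangle[of x v y] dist_commute[of x v] dist_commute[of x y] U siblings.hyps that by auto
    \<comment> \<open>The gain for \<open>d\<close> is bounded from below, hence this inclusion; for
      \<open>cat_dist\<close> the opposite inclusion follows below.\<close>
    have "close_pairs d V k \<union> sibling_pairs x y B k \<subseteq> close_pairs d ?V' k"
      using near xy dist_self[of x] dist_self[of y] U
      by (auto simp: close_pairs_def sibling_pairs_def B_def)
    then have "card (close_pairs d V k \<union> sibling_pairs x y B k) \<le> card (close_pairs d ?V' k)"
      using fin by (intro card_mono) auto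
    moreover have "card (close_pairs d V k \<union> sibling_pairs x y B k) =
        card (close_pairs d V k) + card (sibling_pairs x y B k)"
    proof (rule card_Un_disjoint)
      show "finite (sibling_pairs x y B k)" using fin by (simp add: sibling_pairs_def B_def)
      show "close_pairs d V k \<inter> sibling_pairs x y B k = {}"
        using siblings.hyps by (auto simp: close_pairs_def sibling_pairs_def)
    qed (use fin in simp)
    moreover have "card (sibling_pairs x y B k) = 4 * card B + (if 2 \<le> k then 4 else 2)"
      using fin siblings.hyps by (intro card_sibling_pairs) (auto simp: B_def)
    moreover have "card (sibling_pairs (2 * m) (2 * m + 1) C k) = 4 * card C + (if 2 \<le> k then 4 else 2)"
      by (intro card_sibling_pairs) (auto simp: C_def)
    moreover have "close_pairs cat_dist {..<2 * m + 2} k \<subseteq>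
        close_pairs cat_dist {..<2 * m} k \<union> sibling_pairs (2 * m) (2 * m + 1) C k"
    proof -
      \<comment> \<open>One new vertex is the pendant at position \<open>m\<close>, the other the
        path vertex at position \<open>m + 1\<close>; each is reached from the old vertices through
        \<open>2 * m - 1\<close> only.\<close>
      have far: "cat_dist z w = Suc (cat_dist (2 * m - 1) w)"
        if "w < 2 * m" "z = 2 * m \<or> z = 2 * m + 1" for z w
      proof -
        have "(2 * m - 1 + 1) div 2 = m" "odd (2 * m - 1)" "(2 * m + 1) div 2 = m"
          "(2 * m + 1 + 1) div 2 = Suc m" using m(2) by auto
        moreover have "(w + 1) div 2 \<le> m" using that by linarith
        ultimately show ?thesis using that m(2) by (cases "w = 2 * m - 1") (auto simp: cat_dist_def)
      qed
      then have far': "w \<in> C" if "w < 2 * m" "z = 2 * m \<or> z = 2 * m + 1"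
          "cat_dist z w \<le> k \<or> cat_dist w z \<le> k" for z w
        using that k unfolding C_def by (fastforce simp: cat_dist_sym)
      have "2 \<le> k" if "cat_dist (2 * m) (2 * m + 1) \<le> k"
        using that m(2) unfolding cat_dist_def by (auto split: if_splits)
      then have xy: "2 \<le> k" if "cat_dist (2 * m) (2 * m + 1) \<le> k \<or> cat_dist (2 * m + 1) (2 * m) \<le> k"
        using that cat_dist_sym by metis
      show ?thesis
      proof
        fix p assume "p \<in> close_pairs cat_dist {..<2 * m + 2} k"
        then obtain u w where p: "p = (u, w)" "u < 2 * m + 2" "w < 2 * m + 2" "cat_dist u w \<le> k"
          by (auto simp: close_pairs_def)
        have "u < 2 * m \<or> u = 2 * m \<or> u = 2 * m + 1" "w < 2 * m \<or> w = 2 * m \<or> w = 2 * m + 1"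
          using p by linarith+
        then show "p \<in> close_pairs cat_dist {..<2 * m} k \<union> sibling_pairs (2 * m) (2 * m + 1) C k"
          using p(1,4) far'[of u w] far'[of w u] xy unfolding close_pairs_def sibling_pairs_def
          by (elim disjE) simp_all
      qed
    qed
    then have "card (close_pairs cat_dist {..<2 * m + 2} k) \<le>
        card (close_pairs cat_dist {..<2 * m} k \<union> sibling_pairs (2 * m) (2 * m + 1) C k)"
      by (rule card_mono[rotated]) (auto simp: sibling_pairs_def C_def)
    then have "card (close_pairs cat_dist {..<2 * m + 2} k) \<le>
        card (close_pairs cat_dist {..<2 * m} k) + card (sibling_pairs (2 * m) (2 * m + 1) C k)"
      using card_Un_le le_trans by blast
    moreover have "card (close_pairs cat_dist {..<2 * m} k) \<le> card (close_pairs d V k)"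
      using siblings.IH VU m by simp
    ultimately show ?case using BC card' by simp
  qed
qed

section \<open>Distances in a connected graph\<close>

context pair_graph
begin

lemma gdist_le: "awalk u p v \<Longrightarrow> gdist G u v \<le> length p"
  unfolding gdist_def by (rule Least_le) blast

lemma awalk_length_gdist:
  assumes "awalk u p v"
  obtains q where "awalk u q v" "length q = gdist G u v"
proof -
  have "\<exists>q. awalk u q v \<and> length q = gdist G u v"
    unfolding gdist_def by (rule LeastI[of _ "length p"]) (use assms in blast)
  then show ?thesis using that by blast
qed

lemma gdist_arc_le: "(u, v) \<in> parcs G \<Longrightarrow> gdist G u v \<le> 1"
  using gdist_le[of u "[(u, v)]" v] by (auto simp: awalk_simps dest: wellformed')

end

locale connected_pair_graph = pair_graph +
  assumes connected_graph: "connected_graph G"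
begin

lemma ex_awalk:
  assumes "u \<in> pverts G" "v \<in> pverts G"
  obtains p where "awalk u p v"
proof -
  have "strongly_connected (with_proj G)"
    using connected_graph pair_sym_arcs unfolding connected_graph_def
    by (intro symmetric_connected_imp_strongly_connected) auto
  then show ?thesis
    using assms that unfolding strongly_connected_def reachable_awalk by auto
qed

lemma ex_gdist_awalk:
  assumes "u \<in> pverts G" "v \<in> pverts G"
  obtains p where "awalk u p v" "length p = gdist G u v"
  using assms ex_awalk awalk_length_gdist by metis

lemma gdist_pos:
  assumes "u \<in> pverts G" "v \<in> pverts G" "u \<noteq> v"
  shows "0 < gdist G u v"
  using ex_gdist_awalk[OF assms(1,2)] assms(3) by (metis awalk_empty_ends length_0_conv not_gr_zero)

lemma gdist_sym:
  assumes "u \<in> pverts G" "v \<in> pverts G"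
  shows "gdist G u v = gdist G v u"
proof -
  have "gdist G v u \<le> gdist G u v" if "u \<in> pverts G" "v \<in> pverts G" for u v
  proof -
    have len: "length (rev_path p) = length p" for p :: "('a \<times> 'a) list" by (induction p) auto
    obtain p where "awalk u p v" "length p = gdist G u v"
      using ex_gdist_awalk[OF \<open>u \<in> pverts G\<close> \<open>v \<in> pverts G\<close>] .
    then show ?thesis using gdist_le[of v "rev_path p" u] len by simp
  qed
  then show ?thesis using assms by (simp add: order_antisym)
qed

sublocale nat_metric "pverts G" "gdist G"
proof
  fix u v w assume uvw: "u \<in> pverts G" "v \<in> pverts G" "w \<in> pverts G"
  obtain p q where "awalk u p v" "length p = gdist G u v" "awalk v q w" "length q = gdist G v w"
    using uvw ex_gdist_awalk by metis
  then show "gdist G u w \<le> gdist G u v + gdist G v w"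
    using gdist_le[of u "p @ q" w] awalk_appendI by fastforce
next
  fix u assume "u \<in> pverts G"
  then show "gdist G u u = 0" using gdist_le[of u "[]" u] by (simp add: awalk_Nil_iff)
qed (rule gdist_sym)

section \<open>From distance sequences to counts of close pairs\<close>

lemma pair_gdist_eq:
  assumes "u \<in> pverts G" "v \<in> pverts G" "u \<noteq> v"
  shows "pair_gdist G {u, v} = gdist G u v"
  unfolding pair_gdist_def
  using assms gdist_sym by (intro the_equality) (auto simp: doubleton_eq_iff)

lemma finite_pairs [simp]: "finite {e. e \<subseteq> pverts G \<and> card e = 2}"
  by (rule finite_subset[of _ "Pow (pverts G)"]) (auto simp: pair_finite_verts)

lemma sorted_dist_seq: "sorted (dist_seq G)"
  by (simp add: dist_seq_def)

lemma length_dist_seq: "length (dist_seq G) = card (pverts G) choose 2"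
  using pair_finite_verts
  by (simp add: dist_seq_def size_mset[symmetric] n_subsets del: size_mset)

lemma dist_seq_pos: "x \<in> set (dist_seq G) \<Longrightarrow> 0 < x"
proof -
  assume "x \<in> set (dist_seq G)"
  then obtain e where e: "e \<subseteq> pverts G" "card e = 2" "x = pair_gdist G e"
    by (auto simp: dist_seq_def)
  then show "0 < x" using pair_gdist_eq gdist_pos by (auto simp: card_2_iff)
qed

text \<open>Each entry of the sequence stands for two ordered pairs, and the diagonal adds one pair
  per vertex.\<close>

lemma count_dist_seq:
  "2 * length (filter (\<lambda>x. x \<le> k) (dist_seq G)) + card (pverts G) =
    card (close_pairs (gdist G) (pverts G) k)"
proof -
  define E where "E = {e. e \<subseteq> pverts G \<and> card e = 2 \<and> pair_gdist G e \<le> k}"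
  \<comment> \<open>The two orderings of the pair \<open>e\<close>; these sets are disjoint for
    different \<open>e\<close>.\<close>
  let ?P = "\<lambda>e. {(u, w). {u, w} = e \<and> u \<noteq> w}"
  have finE: "finite E" by (rule finite_subset[OF _ finite_pairs]) (auto simp: E_def)
  have "length (filter (\<lambda>x. x \<le> k) (dist_seq G)) = size (mset (filter (\<lambda>x. x \<le> k) (dist_seq G)))"
    by (simp only: size_mset)
  also have "\<dots> = card {e \<in> {e. e \<subseteq> pverts G \<and> card e = 2}. pair_gdist G e \<le> k}"
    by (simp add: dist_seq_def filter_mset_image_mset filter_mset_mset_set del: size_mset)
  also have "\<dots> = card E" by (rule arg_cong[where f = card]) (auto simp: E_def)
  finally have 1: "length (filter (\<lambda>x. x \<le> k) (dist_seq G)) = card E" .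
  have P: "finite (?P e) \<and> card (?P e) = 2" if e: "e \<in> E" for e
  proof -
    obtain a b where ab: "e = {a, b}" "a \<noteq> b" using e by (auto simp: E_def card_2_iff)
    then have "?P e = {(a, b), (b, a)}" by (auto simp: doubleton_eq_iff)
    then show ?thesis using ab by simp
  qed
  have "card (\<Union>e\<in>E. ?P e) = (\<Sum>e\<in>E. card (?P e))"
    by (rule card_UN_disjoint) (use finE P in auto)
  then have 2: "card (\<Union>e\<in>E. ?P e) = 2 * card E" using P by simp
  have "close_pairs (gdist G) (pverts G) k = (\<Union>e\<in>E. ?P e) \<union> (\<lambda>u. (u, u)) ` pverts G"
  proof (intro set_eqI iffI)
    fix p assume "p \<in> close_pairs (gdist G) (pverts G) k"
    then obtain u w where p: "p = (u, w)" "u \<in> pverts G" "w \<in> pverts G" "gdist G u w \<le> k"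
      by (auto simp: close_pairs_def)
    show "p \<in> (\<Union>e\<in>E. ?P e) \<union> (\<lambda>u. (u, u)) ` pverts G"
    proof (cases "u = w")
      case False
      then have "{u, w} \<in> E" using p pair_gdist_eq by (auto simp: E_def)
      then show ?thesis using False p by blast
    qed (use p in auto)
  next
    fix p assume "p \<in> (\<Union>e\<in>E. ?P e) \<union> (\<lambda>u. (u, u)) ` pverts G"
    then show "p \<in> close_pairs (gdist G) (pverts G) k"
      using dist_self pair_gdist_eq by (auto simp: close_pairs_def E_def)
  qed
  moreover have "card ((\<Union>e\<in>E. ?P e) \<union> (\<lambda>u. (u, u)) ` pverts G) =
      card (\<Union>e\<in>E. ?P e) + card ((\<lambda>u. (u, u)) ` pverts G)"
    by (rule card_Un_disjoint) (use finE P pair_finite_verts in auto)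
  moreover have "card ((\<lambda>u. (u, u)) ` pverts G) = card (pverts G)"
    by (rule card_image) (auto simp: inj_on_def)
  ultimately show ?thesis using 1 2 by simp
qed

end

text \<open>Equal orders give sequences of equal length and equal diagonal contributions, so the
  pair counts compare the sorted sequences entry by entry.\<close>

lemma nondecreasing_index_le:
  assumes I: "nondecreasing_distance_based I"
    and G: "connected_graph G" and H: "connected_graph H"
    and card: "card (pverts G) = card (pverts H)"
    and le: "\<And>k. card (close_pairs (gdist H) (pverts H) k) \<le> card (close_pairs (gdist G) (pverts G) k)"
  shows "I G \<le> I H"
proof -
  interpret G: connected_pair_graph G
    using G unfolding connected_graph_def connected_pair_graph_def connected_pair_graph_axioms_def by simp
  interpret H: connected_pair_graph H
    using H unfolding connected_graph_def connected_pair_graph_def connected_pair_graph_axioms_def by simp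
  obtain g where g: "distance_based_via I g" "coordinatewise_nondecreasing g"
    using I unfolding nondecreasing_distance_based_def by blast
  have counts: "length (filter (\<lambda>y. y \<le> k) (dist_seq H)) \<le> length (filter (\<lambda>x. x \<le> k) (dist_seq G))" for k
    using le[of k] G.count_dist_seq[of k] H.count_dist_seq[of k] card by simp
  have len: "length (dist_seq G) = length (dist_seq H)"
    using G.length_dist_seq H.length_dist_seq card by simp
  have "g (dist_seq G) \<le> g (dist_seq H)"
  proof (rule coordinatewise_nondecreasingD[OF g(2) len])
    show "\<forall>x\<in>set (dist_seq G). 0 < x" using G.dist_seq_pos by blast
    show "dist_seq G ! i \<le> dist_seq H ! i" if "i < length (dist_seq G)" for i
      using G.sorted_dist_seq H.sorted_dist_seq len that counts by (rule sorted_nth_le_nth_if_counts)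
  qed
  then show ?thesis using g(1) G H unfolding distance_based_via_def by simp
qed

text \<open>Reduces the second half of the theorem to the first.\<close>

lemma nonincreasing_imp_nondecreasing_uminus:
  assumes "nonincreasing_distance_based I"
  shows "nondecreasing_distance_based (\<lambda>G. - I G)"
proof -
  obtain g where "distance_based_via I g" "coordinatewise_nonincreasing g"
    using assms unfolding nonincreasing_distance_based_def by blast
  then have "distance_based_via (\<lambda>G. - I G) (\<lambda>xs. - g xs)" "coordinatewise_nondecreasing (\<lambda>xs. - g xs)"
    by (simp_all add: distance_based_via_def coordinatewise_nonincreasing_def
        coordinatewise_nondecreasing_def)
  then show ?thesis unfolding nondecreasing_distance_based_def by blast
qed

section \<open>Odd trees\<close>

text \<open>Supplies the arc along which a partial tree \<open>U\<close> is extended by a new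
  vertex.\<close>

lemma (in pair_wf_digraph) awalk_leaves_set:
  assumes "awalk u p z" "u \<in> U" "z \<notin> U"
  shows "\<exists>a b. (a, b) \<in> parcs G \<and> a \<in> U \<and> b \<notin> U"
  using assms
proof (induction p arbitrary: u)
  case (Cons e p)
  then show ?case
    by (cases e; cases "snd e \<in> U") (auto simp: awalk_Cons_iff)
qed (auto simp: awalk_Nil_iff)

text \<open>If \<open>a\<close> and \<open>b\<close> differed, the walk would shorten to a nonempty
  path avoiding \<open>w\<close>, and the arcs from \<open>w\<close> to \<open>a\<close> and from
  \<open>b\<close> to \<open>w\<close> would close it to a cycle of length at least 3.\<close>

lemma (in connected_pair_graph) unique_neighbour_if_acyclic:
  assumes acyclic: "\<nexists>p. cycle p \<and> 3 \<le> length p"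
    and walk: "awalk a p b" "set (awalk_verts a p) \<subseteq> U"
    and w: "w \<notin> U" "(w, a) \<in> parcs G" "(b, w) \<in> parcs G"
  shows "a = b"
proof (rule ccontr)
  assume "a \<noteq> b"
  define q where "q = awalk_to_apath p"
  have q: "apath a q b" and sub: "set q \<subseteq> set p"
    using apath_awalk_to_apath[OF walk(1)] awalk_to_apath_subset[OF walk(1)] by (auto simp: q_def)
  have qw: "awalk a q b" "distinct (awalk_verts a q)" using q by (auto simp: apath_def)
  have "q \<noteq> []" using qw(1) \<open>a \<noteq> b\<close> by (auto simp: awalk_Nil_iff)
  have "set (awalk_verts a q) \<subseteq> set (awalk_verts a p)"
    using set_awalk_verts[OF qw(1)] set_awalk_verts[OF walk(1)] sub by auto
  then have w': "w \<notin> set (awalk_verts a q)" using walk(2) w(1) by blast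
  let ?c = "(w, a) # q @ [(b, w)]"
  have aw: "awalk a (q @ [(b, w)]) w"
    using qw(1) w by (intro awalk_appendI[OF qw(1)]) (auto simp: awalk_simps dest: wellformed')
  then have "awalk w ?c w" using w by (auto simp: awalk_Cons_iff dest: wellformed')
  moreover have "awalk_verts a (q @ [(b, w)]) = awalk_verts a q @ [w]"
    using awalk_verts_append[OF aw] by simp
  then have "distinct (tl (awalk_verts w ?c))"
    using qw(2) w' by simp
  ultimately have "cycle ?c" unfolding cycle_def by blast
  moreover have "3 \<le> length ?c" using \<open>q \<noteq> []\<close> by (cases q) auto
  ultimately show False using acyclic by blast
qed

text \<open>The depth h makes the parent relation well-founded.\<close>

definition parent_tree :: "'a rel \<Rightarrow> 'a set \<Rightarrow> 'a \<Rightarrow> ('a \<Rightarrow> 'a) \<Rightarrow> ('a \<Rightarrow> nat) \<Rightarrow> bool" where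
  "parent_tree E U r par h \<longleftrightarrow> r \<in> U \<and> h r = 0 \<and>
     (\<forall>v \<in> U - {r}. par v \<in> U \<and> h v = Suc (h (par v))) \<and>
     (\<forall>u \<in> U. \<forall>w \<in> U. (u, w) \<in> E \<longleftrightarrow> (u \<noteq> r \<and> par u = w) \<or> (w \<noteq> r \<and> par w = u))"

text \<open>The tree grows from \<open>{r}\<close> by one vertex \<open>w\<close> at a time, with
  the endpoint \<open>a\<close> in \<open>U\<close> of a crossing arc as its parent. Acyclicity
  makes \<open>a\<close> the only neighbour of \<open>w\<close> in \<open>U\<close>.\<close>

lemma (in connected_pair_graph) ex_parent_tree:
  assumes acyclic: "\<nexists>p. cycle p \<and> 3 \<le> length p"
    and r: "r \<in> pverts G"
  shows "\<exists>par h. parent_tree (parcs G) (pverts G) r par h"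
proof -
  \<comment> \<open>Walks staying inside \<open>U\<close> are kept as part of the invariant, since
    the uniqueness of the neighbour of a new vertex needs a walk that avoids it.\<close>
  let ?linked = "\<lambda>U. \<forall>a \<in> U. \<forall>b \<in> U. \<exists>p. awalk a p b \<and> set (awalk_verts a p) \<subseteq> U"
  have "\<exists>U par h. U \<subseteq> pverts G \<and> card U = Suc k \<and> parent_tree (parcs G) U r par h \<and> ?linked U"
    if "k < card (pverts G)" for k
    using that
  proof (induction k)
    case 0
    have "parent_tree (parcs G) {r} r par (\<lambda>_. 0)" for par
      using no_loops' by (auto simp: parent_tree_def)
    moreover have "?linked {r}"
      using r by (auto intro!: exI[of _ "[]"] simp: awalk_Nil_iff)
    ultimately show ?case using r by (intro exI[of _ "{r}"]) auto
  next
    case (Suc k)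
    then obtain U par h where U: "U \<subseteq> pverts G" "card U = Suc k"
      and pt: "parent_tree (parcs G) U r par h" and linked: "?linked U"
      by auto
    have fin: "finite U" using U pair_finite_verts finite_subset by blast
    have rU: "r \<in> U" using pt by (simp add: parent_tree_def)
    have "U \<noteq> pverts G" using U Suc.prems by auto
    then obtain z where z: "z \<in> pverts G" "z \<notin> U" using U by auto
    obtain p where "awalk r p z" using ex_awalk[OF r z(1)] .
    then obtain a w where aw: "(a, w) \<in> parcs G" "a \<in> U" "w \<notin> U"
      using awalk_leaves_set[OF _ rU z(2)] by blast
    have wa: "(w, a) \<in> parcs G" using aw arcs_symmetric by blast
    have wV: "w \<in> pverts G" using aw wellformed' by blast
    have uniq: "b = a" if b: "b \<in> U" "(b, w) \<in> parcs G" for b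
    proof -
      obtain p where "awalk a p b" "set (awalk_verts a p) \<subseteq> U" 
        using linked[rule_format, OF aw(2) b(1)] by blast
      then show ?thesis using unique_neighbour_if_acyclic[OF acyclic _ _ aw(3) wa b(2)] by metis
    qed
    have uniq': "b = a" if "b \<in> U" "(w, b) \<in> parcs G" for b
      using uniq that arcs_symmetric by blast
    let ?U = "insert w U"
    have "(w, w) \<notin> parcs G" using no_loops' by blast
    have "w \<noteq> r" using aw(3) rU by blast
    have "parent_tree (parcs G) ?U r (par(w := a)) (h(w := Suc (h a)))"
      unfolding parent_tree_def
    proof (intro conjI ballI)
      show "r \<in> ?U" "(h(w := Suc (h a))) r = 0"
        using rU pt \<open>w \<noteq> r\<close> by (simp_all add: parent_tree_def)
      fix v assume v: "v \<in> ?U - {r}"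
      have "par v \<in> U \<and> h v = Suc (h (par v))" if "v \<noteq> w" using pt v that by (simp add: parent_tree_def)
      then show "(par(w := a)) v \<in> ?U" "(h(w := Suc (h a))) v = Suc ((h(w := Suc (h a))) ((par(w := a)) v))"
        using aw by auto
    next
      fix u v assume uv: "u \<in> ?U" "v \<in> ?U"
      have par: "par x \<noteq> w" if "x \<in> U" "x \<noteq> r" for x
        using pt that aw(3) unfolding parent_tree_def by blast
      consider "u \<in> U" "v \<in> U" | "u = w" "v \<in> U" | "u \<in> U" "v = w" | "u = w" "v = w" using uv by blast
      then show "(u, v) \<in> parcs G \<longleftrightarrow>
          (u \<noteq> r \<and> (par(w := a)) u = v) \<or> (v \<noteq> r \<and> (par(w := a)) v = u)"
      proof cases
        case 1
        then have "(u, v) \<in> parcs G \<longleftrightarrow> (u \<noteq> r \<and> par u = v) \<or> (v \<noteq> r \<and> par v = u)"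
          using pt by (simp add: parent_tree_def)
        then show ?thesis using 1 aw(3) by auto
      next
        case 2
        then show ?thesis using uniq'[of v] par[of v] wa \<open>w \<noteq> r\<close> aw(3) by auto
      next
        case 3
        then show ?thesis using uniq[of u] par[of u] aw \<open>w \<noteq> r\<close> by auto
      next
        case 4
        then show ?thesis using \<open>(w, w) \<notin> parcs G\<close> aw by auto
      qed
    qed
    moreover have "?linked ?U"
    proof (intro ballI)
      fix b c assume bc: "b \<in> ?U" "c \<in> ?U"
      \<comment> \<open>Any two vertices of the enlarged set are linked by a walk through
        \<open>a\<close>.\<close>
      have to_a: "\<exists>p. awalk b p a \<and> set (awalk_verts b p) \<subseteq> ?U" if "b \<in> ?U" for b
      proof (cases "b = w")
        case True
        then have "awalk b [(w, a)] a" using wa by (auto simp: awalk_simps dest: wellformed')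
        then show ?thesis using True aw by (intro exI[of _ "[(w, a)]"]) auto
      next
        case False
        then have "b \<in> U" using that by simp
        then show ?thesis using linked[rule_format, OF _ aw(2)] by blast
      qed
      obtain p q where p: "awalk b p a" "set (awalk_verts b p) \<subseteq> ?U"
        and q: "awalk c q a" "set (awalk_verts c q) \<subseteq> ?U" using to_a bc by metis
      have q': "awalk a (rev_path q) c" using q by simp
      have "set (awalk_verts a (rev_path q)) \<subseteq> ?U" using q awalk_verts_rev_path[OF q(1)] by simp
      moreover have "awalk b (p @ rev_path q) c" using awalk_appendI[OF p(1) q'] .
      moreover from this have "set (awalk_verts b (p @ rev_path q)) =
          set (awalk_verts b p) \<union> set (awalk_verts a (rev_path q))"
        using set_awalk_verts_append[OF p(1) q'] by simp
      ultimately show "\<exists>p. awalk b p c \<and> set (awalk_verts b p) \<subseteq> ?U"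
        using p(2) by (intro exI[of _ "p @ rev_path q"]) auto
    qed
    moreover have "?U \<subseteq> pverts G" "card ?U = Suc (Suc k)" using U wV fin aw by auto
    ultimately show ?case by blast
  qed
  moreover have "0 < card (pverts G)" using r pair_finite_verts by (auto simp: card_gt_0_iff)
  ultimately obtain U par h where "U \<subseteq> pverts G" "card U = Suc (card (pverts G) - 1)"
      "parent_tree (parcs G) U r par h"
    by (metis diff_less zero_less_one)
  then show ?thesis
    using card_subset_eq[OF pair_finite_verts, of U] \<open>0 < card (pverts G)\<close> by auto
qed

text \<open>A deepest vertex \<open>x\<close> has a sibling \<open>y\<close>: otherwise its parent
  would have degree 2, or the tree would be a single edge. Both are leaves, and deleting them
  changes only the degree of their parent, by 2, so all degrees stay odd.\<close>

lemma parent_tree_sibling_built: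
  assumes "finite V" "parent_tree E V r par h"
    and "\<forall>v \<in> V. odd (card {w \<in> V. (v, w) \<in> E})"
    and adj: "\<And>u w. (u, w) \<in> E \<Longrightarrow> adj u w"
  shows "sibling_built adj V"
  using assms(1-3)
proof (induction "card V" arbitrary: V rule: less_induct)
  case less
  note fin = less.prems(1) and pt = less.prems(2) and deg = less.prems(3)
  have r: "r \<in> V" "h r = 0" using pt by (simp_all add: parent_tree_def)
  have par: "par u \<in> V" "h u = Suc (h (par u))" if "u \<in> V" "u \<noteq> r" for u
    using pt that by (simp_all add: parent_tree_def)
  have edge: "(u, w) \<in> E \<longleftrightarrow> (u \<noteq> r \<and> par u = w) \<or> (w \<noteq> r \<and> par w = u)"
    if "u \<in> V" "w \<in> V" for u w
    using pt that by (simp add: parent_tree_def)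
  have noloop: "(u, u) \<notin> E" if "u \<in> V" for u
    using edge[OF that that] par[OF that] by fastforce
  \<comment> \<open>An odd degree is not zero, so there is a vertex besides the root and the maximum
    \<open>D\<close> is taken over a nonempty set.\<close>
  have "{w \<in> V. (r, w) \<in> E} \<noteq> {}" using deg r(1) by (metis card.empty even_zero)
  then obtain w where "w \<in> V" "(r, w) \<in> E" by auto
  then have ne: "V - {r} \<noteq> {}" using noloop[OF r(1)] by auto
  define D where "D = Max (h ` (V - {r}))"
  have hD: "h u \<le> D" if "u \<in> V" "u \<noteq> r" for u
    using that fin by (auto simp: D_def)
  have "D \<in> h ` (V - {r})" unfolding D_def using fin ne by (intro Max_in) auto
  then obtain x where x: "x \<in> V" "x \<noteq> r" "h x = D" by auto
  define v where "v = par x"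
  have v: "v \<in> V" "D = Suc (h v)" using par[OF x(1,2)] x(3) by (simp_all add: v_def)
  have vx: "v \<noteq> x" using v(2) x(3) by auto
  \<comment> \<open>A child of \<open>z\<close> would have depth \<open>D + 1\<close>, beyond the
    maximum.\<close>
  have childless: "par u \<noteq> z" if "u \<in> V" "u \<noteq> r" "h z = D" for u z
    using par[OF that(1,2)] hD[OF that(1,2)] that(3) by auto
  define C where "C = {u \<in> V - {r}. par u = v}"
  have xC: "x \<in> C" using x by (simp add: C_def v_def)
  have finC: "finite C" using fin by (simp add: C_def)
  show ?case
  proof (cases "card V = 2")
    case True
    have "{v, x} \<subseteq> V" "card {v, x} = 2" using v vx x by auto
    then have "V = {v, x}" using card_subset_eq[OF fin, of "{v, x}"] True by simp
    moreover have "adj v x" using adj edge[OF v(1) x(1)] x(2) v_def by blast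
    ultimately show ?thesis using sibling_built.edge[of adj v x] vx by simp
  next
    case False
    have "C \<noteq> {x}"
    proof
      assume Cx: "C = {x}"
      show False
      proof (cases "v = r")
        case True
        \<comment> \<open>With \<open>v = r\<close> the maximal depth is 1, so every other vertex is
          a child of the root.\<close>
        have "par u = r" if "u \<in> V" "u \<noteq> r" for u
          using par[OF that] hD[OF that] par(2)[of "par u"] v(2) True r(2) by fastforce
        then have "V = {r, x}" using Cx True r(1) x(1) by (auto simp: C_def)
        then show False using False x(2) by auto
      next
        case vr: False
        have "{w \<in> V. (v, w) \<in> E} = insert (par v) C"
          using edge[OF v(1)] par[OF v(1) vr] vr by (auto simp: C_def)
        moreover have "par v \<noteq> x" using childless[OF v(1) vr x(3)] .
        ultimately have "card {w \<in> V. (v, w) \<in> E} = 2" using Cx by simp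
        then show False using deg v(1) by fastforce
      qed
    qed
    then obtain y where y: "y \<in> V" "y \<noteq> r" "par y = v" "y \<noteq> x" using xC by (auto simp: C_def)
    have hy: "h y = D" using par[OF y(1,2)] y(3) v(2) by simp
    have vy: "v \<noteq> y" using hy v(2) by auto
    let ?V = "V - {x, y}"
    have nbr: "u = v" if "u \<in> V" "(u, z) \<in> E" "z = x \<or> z = y" for u z
      using that edge[of u z] childless[of u z] x y hy v_def by auto
    have Vxy: "V = insert x (insert y ?V)" using x y by auto
    have "sibling_built adj ?V"
    proof (rule less.hyps)
      show "card ?V < card V" using fin x(1) by (intro psubset_card_mono) auto
      show "finite ?V" using fin by simp
      show "parent_tree E ?V r par h"
        unfolding parent_tree_def
      proof (intro conjI ballI)
        fix u assume u: "u \<in> ?V - {r}"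
        then show "par u \<in> ?V" using par(1)[of u] childless[of u x] childless[of u y] x(3) hy by auto
        show "h u = Suc (h (par u))" using u par(2)[of u] by auto
      qed (use r x y edge in auto)
      show "\<forall>u \<in> ?V. odd (card {w \<in> ?V. (u, w) \<in> E})"
      proof
        fix u assume u: "u \<in> ?V"
        have odd: "odd (card {w \<in> V. (u, w) \<in> E})" using deg u by simp
        have eq: "{w \<in> ?V. (u, w) \<in> E} = {w \<in> V. (u, w) \<in> E} - {x, y}" by auto
        show "odd (card {w \<in> ?V. (u, w) \<in> E})"
        proof (cases "u = v")
          case True
          then have sub: "{x, y} \<subseteq> {w \<in> V. (u, w) \<in> E}"
            using edge[OF v(1)] x y v_def by auto
          then have "card ({w \<in> V. (u, w) \<in> E} - {x, y}) = card {w \<in> V. (u, w) \<in> E} - 2"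
            using y(4) by (subst card_Diff_subset) auto
          moreover have "card {x, y} \<le> card {w \<in> V. (u, w) \<in> E}"
            using sub fin by (intro card_mono) auto
          ultimately show ?thesis using odd eq y(4) by auto
        next
          case False
          then have "{w \<in> V. (u, w) \<in> E} - {x, y} = {w \<in> V. (u, w) \<in> E}"
            using nbr u by blast
          then show ?thesis using odd eq by simp
        qed
      qed
    qed
    moreover have "(v, x) \<in> E" "(v, y) \<in> E"
      using edge v(1) x y v_def by auto
    ultimately show ?thesis
      using sibling_built.siblings[of adj ?V v x y] v vx vy y(4) adj Vxy by auto
  qed
qed

lemma odd_tree_sibling_built:
  assumes "odd_tree T"
  shows "sibling_built (\<lambda>u v. gdist T u v \<le> 1) (pverts T)"
proof -
  have T: "connected_graph T" "\<nexists>p. pre_digraph.cycle (with_proj T) p \<and> 3 \<le> length p"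
    and odd: "\<forall>v \<in> pverts T. odd (out_degree (with_proj T) v)"
    using assms unfolding odd_tree_def tree_graph_def by auto
  interpret connected_pair_graph T
    using T unfolding connected_graph_def connected_pair_graph_def connected_pair_graph_axioms_def by simp
  have "pverts T \<noteq> {}" using T(1) by (auto simp: connected_graph_def connected_conv)
  then obtain r where "r \<in> pverts T" by blast
  then obtain par h where pt: "parent_tree (parcs T) (pverts T) r par h"
    using ex_parent_tree[OF T(2)] by blast
  have "card {w \<in> pverts T. (v, w) \<in> parcs T} = out_degree (with_proj T) v" for v
  proof -
    have "out_arcs (with_proj T) v = Pair v ` {w \<in> pverts T. (v, w) \<in> parcs T}"
      by (auto simp: out_arcs_def dest: wellformed')
    then show ?thesis by (simp add: out_degree_def card_image inj_on_def)
  qed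
  then show ?thesis
    using pair_finite_verts pt odd gdist_arc_le
    by (intro parent_tree_sibling_built[OF _ pt]) auto
qed

section \<open>The extremal tree\<close>

text \<open>The potential \<open>D\<close> drops by at most 1 along each arc and vanishes at
  \<open>z\<close>, hence bounds walk lengths from below.\<close>

lemma (in pair_wf_digraph) awalk_length_ge:
  assumes "awalk x p z"
    and "\<And>x y. (x, y) \<in> parcs G \<Longrightarrow> D x \<le> Suc (D y)" "D z = (0::nat)"
  shows "D x \<le> length p"
  using assms(1)
proof (induction p arbitrary: x)
  case (Cons e p)
  then have "D (snd e) \<le> length p" "D x \<le> Suc (D (snd e))"
    using assms(2)[of x "snd e"] by (auto simp: awalk_Cons_iff)
  then show ?case by simp
qed (use assms(3) in \<open>auto simp: awalk_Nil_iff\<close>)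

text \<open>Translates the numbering of \<^const>\<open>T_graph\<close> into that of \<^const>\<open>cat_dist\<close>.\<close>

definition cat_label :: "nat \<Rightarrow> nat \<Rightarrow> nat" where
  "cat_label m a = (if a = 0 then 0 else if a \<le> m then 2 * a - 1 else 2 * (a - m))"

lemma cat_label_less: "a < 2 * m \<Longrightarrow> cat_label m a < 2 * m"
  by (auto simp: cat_label_def)

lemma inj_cat_label: "inj_on (cat_label m) A"
proof (rule inj_onI)
  fix a b assume "cat_label m a = cat_label m b"
  then show "a = b" unfolding cat_label_def by (simp split: if_splits) presburger+
qed

text \<open>In terms of path positions and pendant edges, parities and halves disappear, so that
  linear arithmetic suffices afterwards.\<close>

lemma cat_dist_label:
  "cat_dist (cat_label m a) (cat_label m b) = (if a = b then 0 else
    (let p = (if a \<le> m then a else a - m); q = (if b \<le> m then b else b - m) in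
     (p - q) + (q - p) + (if a \<le> m then 0 else 1) + (if b \<le> m then 0 else 1)))"
proof -
  have 1: "Suc (cat_label m a) div 2 = (if a \<le> m then a else a - m)" for a
    by (auto simp: cat_label_def)
  have 2: "even (cat_label m a) \<and> 0 < cat_label m a \<longleftrightarrow> m < a" for a
    by (auto simp: cat_label_def)
  have "cat_label m a = cat_label m b \<longleftrightarrow> a = b"
    using inj_cat_label[of m UNIV] by (auto simp: inj_on_def)
  then show ?thesis by (simp add: cat_dist_def 1 2)
qed

text \<open>This is the condition that \<open>awalk_length_ge\<close> puts on the potential, checked
  for both directions of path edges and pendant edges.\<close>

lemma cat_dist_label_arc:
  assumes "(a, b) \<in> parcs (T_graph n)"
  shows "cat_dist (cat_label (n div 2) a) (cat_label (n div 2) c) \<le>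
    Suc (cat_dist (cat_label (n div 2) b) (cat_label (n div 2) c))"
proof -
  define m where "m = n div 2"
  have "(a < m \<and> b = Suc a) \<or> (0 < a \<and> a < m \<and> b = m + a) \<or>
     (b < m \<and> a = Suc b) \<or> (0 < b \<and> b < m \<and> a = m + b)"
    using assms unfolding in_parcs_T_graph m_def .
  then show ?thesis unfolding m_def[symmetric] cat_dist_label Let_def
    by (elim disjE conjE; cases "c \<le> m"; cases "a = c"; cases "b = c"; simp; linarith?)
qed

lemma connected_graph_T_graph:
  assumes "even n" "4 \<le> n"
  shows "connected_graph (T_graph n)"
proof -
  interpret pair_graph "T_graph n" using assms by (rule pair_graph_T_graph)
  have arc: "a \<rightarrow>\<^sup>*\<^bsub>with_proj (T_graph n)\<^esub> b" if "(a, b) \<in> parcs (T_graph n)" for a b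
    using that by (intro reachable_adjI) simp
  have path: "0 \<rightarrow>\<^sup>*\<^bsub>with_proj (T_graph n)\<^esub> a" if "a \<le> n div 2" for a
    using that
  proof (induction a)
    case 0
    then show ?case using assms by simp
  next
    case (Suc a)
    then have "a \<rightarrow>\<^sup>*\<^bsub>with_proj (T_graph n)\<^esub> Suc a" by (intro arc) (simp add: in_parcs_T_graph)
    moreover have "0 \<rightarrow>\<^sup>*\<^bsub>with_proj (T_graph n)\<^esub> a" using Suc by simp
    ultimately show ?case using reachable_trans by blast
  qed
  have "0 \<rightarrow>\<^sup>*\<^bsub>with_proj (T_graph n)\<^esub> a" if "a < n" for a
  proof (cases "a \<le> n div 2")
    case False
    \<comment> \<open>The leaf \<open>a\<close> hangs off path vertex \<open>a - n div 2\<close>;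
      evenness of \<open>n\<close> makes that vertex internal.\<close>
    then have "(a - n div 2, a) \<in> parcs (T_graph n)"
      using that assms(1) by (auto simp: in_parcs_T_graph elim!: evenE)
    then have "(a - n div 2) \<rightarrow>\<^sup>*\<^bsub>with_proj (T_graph n)\<^esub> a" by (rule arc)
    moreover have "a - n div 2 \<le> n div 2" using that by simp
    ultimately show ?thesis using path reachable_trans by blast
  qed (rule path)
  then have "a \<rightarrow>\<^sup>*\<^bsub>with_proj (T_graph n)\<^esub> b" if "a < n" "b < n" for a b
    using that symmetric_reachable[OF pair_sym_arcs] reachable_trans by metis
  then have "Digraph_Component.connected (with_proj (T_graph n))"
    using assms by (intro connectedI) (auto simp: reachable_mk_symmetric_eq[OF pair_sym_arcs] lessThan_empty_iff bot_nat_def)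
  then show ?thesis by (simp add: connected_graph_def pair_graph_axioms)
qed

section \<open>Isomorphic copies of the extremal tree\<close>

lemma pair_digraph_isoE:
  assumes "digraph_iso (with_proj G) (with_proj H)" "pair_graph G"
  obtains f where "inj_on f (pverts G)" "pverts H = f ` pverts G"
    "parcs H = (\<lambda>(a, b). (f a, f b)) ` parcs G"
proof -
  interpret G: pair_graph G by fact
  obtain i where i: "G.digraph_isomorphism i" "with_proj H = app_iso i (with_proj G)"
    using assms unfolding digraph_iso_def by blast
  let ?f = "iso_verts i"
  have "verts (with_proj H) = ?f ` pverts G" unfolding i(2) by simp
  moreover have "arcs_ends (with_proj H) = (\<lambda>(a, b). (?f a, ?f b)) ` parcs G"
    unfolding i(2) using G.arcs_ends_app_iso_eq[OF i(1)] by simp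
  ultimately show ?thesis
    using that[of ?f] G.digraph_isomorphism_inj_on_verts[OF i(1)] by simp
qed

text \<open>That \<open>H\<close> is a finite simple graph is derived from the vertex map;
  connectedness comes from the isomorphism itself.\<close>

lemma connected_graph_iso:
  assumes iso: "digraph_iso (with_proj G) (with_proj H)" and G: "connected_graph G"
  shows "connected_graph H"
proof -
  interpret G: pair_graph G using G by (simp add: connected_graph_def)
  obtain f where f: "inj_on f (pverts G)" "pverts H = f ` pverts G"
    "parcs H = (\<lambda>(a, b). (f a, f b)) ` parcs G"
    using pair_digraph_isoE[OF iso G.pair_graph] .
  have "sym (parcs H)"
    unfolding f(3) using G.arcs_symmetric by (intro symI) auto
  moreover have "fst e \<in> pverts H \<and> snd e \<in> pverts H \<and> fst e \<noteq> snd e" if e: "e \<in> parcs H" for e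
  proof -
    obtain a b where ab: "(a, b) \<in> parcs G" "e = (f a, f b)" using e f(3) by auto
    then have "a \<in> pverts G" "b \<in> pverts G" "a \<noteq> b" using G.wellformed' G.no_loops' by auto
    then show ?thesis using ab f by (auto simp: inj_on_def)
  qed
  moreover have "finite (pverts H)" "finite (parcs H)"
    using f G.pair_finite_verts G.pair_finite_arcs by auto
  ultimately have "pair_graph H" by unfold_locales (auto simp: symmetric_def)
  moreover obtain i where "G.digraph_isomorphism i" "with_proj H = app_iso i (with_proj G)"
    using iso unfolding digraph_iso_def by blast
  then have "Digraph_Component.connected (with_proj H)"
    using G.connectedI_app_iso G by (simp add: connected_graph_def)
  ultimately show ?thesis by (simp add: connected_graph_def)
qed

text \<open>It suffices that \<open>cat_dist\<close> bounds the distances of \<open>S\<close> from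
  below: an injective relabelling then sends close pairs of \<open>S\<close> to close pairs for
  \<open>cat_dist\<close>.\<close>

lemma close_pairs_iso_T_graph:
  assumes iso: "digraph_iso (with_proj (T_graph n)) (with_proj S)" and n: "even n" "4 \<le> n"
  shows "card (close_pairs (gdist S) (pverts S) k) \<le> card (close_pairs cat_dist {..<n} k)"
    and "card (pverts S) = n"
proof -
  interpret S: connected_pair_graph S
    using connected_graph_iso[OF iso connected_graph_T_graph[OF n]]
    unfolding connected_graph_def connected_pair_graph_def connected_pair_graph_axioms_def by simp
  obtain f where f: "inj_on f {..<n}" "pverts S = f ` {..<n}"
    "parcs S = (\<lambda>(a, b). (f a, f b)) ` parcs (T_graph n)"
    using pair_digraph_isoE[OF iso pair_graph_T_graph[OF n]] by auto
  show "card (pverts S) = n" using f by (simp add: card_image)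
  \<comment> \<open>The isomorphism is undone first, then the vertex of \<open>T_graph n\<close> is
    renumbered.\<close>
  define l where "l x = cat_label (n div 2) (the_inv_into {..<n} f x)" for x
  have lf: "l (f a) = cat_label (n div 2) a" if "a < n" for a
    using the_inv_into_f_f[OF f(1)] that by (simp add: l_def)
  have l_less: "l x < n" if "x \<in> pverts S" for x
    using that f(2) lf cat_label_less[of _ "n div 2"] n by auto
  have l_inj: "inj_on l (pverts S)"
    using f(2) lf inj_cat_label[of "n div 2" "{..<n}"] by (auto simp: inj_on_def)
  have arc: "cat_dist (l x) (l z) \<le> Suc (cat_dist (l y) (l z))"
    if "(x, y) \<in> parcs S" "z \<in> pverts S" for x y z
  proof -
    obtain a b c where abc: "(a, b) \<in> parcs (T_graph n)" "x = f a" "y = f b" "z = f c" "c < n"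
      using \<open>(x, y) \<in> parcs S\<close> \<open>z \<in> pverts S\<close> f by auto
    moreover have "a < n" "b < n"
      using abc(1) pair_wf_digraph.wellformed'[of "T_graph n" a b] pair_graph_T_graph[OF n]
      by (auto simp: pair_graph_def pair_digraph_def pair_fin_digraph_def)
    ultimately show ?thesis using cat_dist_label_arc[OF abc(1)] lf by simp
  qed
  have far: "cat_dist (l x) (l z) \<le> gdist S x z" if xz: "x \<in> pverts S" "z \<in> pverts S" for x z
  proof -
    obtain p where p: "S.awalk x p z" "length p = gdist S x z" using S.ex_gdist_awalk[OF xz] .
    then show ?thesis
      using S.awalk_length_ge[OF p(1), of "\<lambda>x. cat_dist (l x) (l z)"] arc xz
      by (simp add: cat_dist_eq_0_iff)
  qed
  let ?l = "\<lambda>(x, z). (l x, l z)"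
  have "card (close_pairs (gdist S) (pverts S) k) = card (?l ` close_pairs (gdist S) (pverts S) k)"
    using l_inj by (intro card_image[symmetric]) (auto simp: inj_on_def close_pairs_def)
  also have "\<dots> \<le> card (close_pairs cat_dist {..<n} k)"
  proof (rule card_mono)
    show "?l ` close_pairs (gdist S) (pverts S) k \<subseteq> close_pairs cat_dist {..<n} k"
      using far l_less by (auto simp: close_pairs_def intro: le_trans)
  qed simp
  finally show "card (close_pairs (gdist S) (pverts S) k) \<le> card (close_pairs cat_dist {..<n} k)" .
qed

theorem theorem4:
  fixes T S :: "'a pair_pre_digraph"
    and I :: "'a pair_pre_digraph \<Rightarrow> real"
    and n :: nat
  assumes "odd_tree T"
    and "card (pverts T) = n"
    and "4 \<le> n"
    and "digraph_iso (with_proj (T_graph n)) (with_proj S)"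
  shows "(nondecreasing_distance_based I \<longrightarrow> I T \<le> I S) \<and>
         (nonincreasing_distance_based I \<longrightarrow> I T \<ge> I S)"
proof -
  have T: "connected_graph T" using assms(1) by (simp add: odd_tree_def tree_graph_def)
  interpret T: connected_pair_graph T
    using T unfolding connected_graph_def connected_pair_graph_def connected_pair_graph_axioms_def by simp
  have built: "sibling_built (\<lambda>u v. gdist T u v \<le> 1) (pverts T)"
    using assms(1) by (rule odd_tree_sibling_built)
  \<comment> \<open>Evenness comes from the construction by pairs of siblings, which starts from an
    edge.\<close>
  have n: "even n" "4 \<le> n" using sibling_built_even[OF built] assms by simp_all
  have S: "connected_graph S"
    using connected_graph_iso[OF assms(4) connected_graph_T_graph[OF n]] .
  have "card (pverts T) = card (pverts S)"
    using assms(2) close_pairs_iso_T_graph(2)[OF assms(4) n] by simp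
  moreover have "card (close_pairs (gdist S) (pverts S) k) \<le> card (close_pairs (gdist T) (pverts T) k)" for k
    using close_pairs_iso_T_graph(1)[OF assms(4) n, of k] T.close_pairs_cat_dist_le[OF built, of k] assms(2)
    by simp
  \<comment> \<open>Stated for an arbitrary index, so that it applies both to \<open>I\<close> and
    to its negative.\<close>
  ultimately have "I' T \<le> I' S" if "nondecreasing_distance_based I'" for I' :: "'a pair_pre_digraph \<Rightarrow> real"
    using nondecreasing_index_le[OF that T S] by blast
  from this[of I] this[of "\<lambda>G. - I G"] show ?thesis
    using nonincreasing_imp_nondecreasing_uminus[of I] by auto
qed

end
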